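(* Let $R$ be a (not necessarily unital) ring and let $R'$ be its unitalization. If $\sigma : R \to R$ is a ring endomorphism and $\delta : R \to R$ is a $\sigma$-derivation, then $\sigma$ and $\delta$ have extensions $\tilde{\sigma} : R' \to R'$ and $\tilde{\delta} : R' \to R'$, respectively, such that $\tilde{\sigma}$ is a ring endomorphism of $R'$ respecting the multiplicative identity element (i.e. mapping it to itself) and $\tilde{\delta}$ is a $\tilde{\sigma}$-derivation.
   Context: All rings are associative but not necessarily unital; a ring endomorphism is an additive and multiplicative map. Given a ring endomorphism $\sigma$ of a ring $A$, a $\sigma$-derivation of $A$ is an additive map $\delta : A \to A$ with $\delta(rs) = \sigma(r)\delta(s) + \delta(r)s$ for all $r,s \in A$. The unitalization $R'$ of $R$ is the set $R \times \mathbb{Z}$ with componentwise addition and multiplication $(r,n)(s,m) = (rs + ns + mr, nm)$; its multiplicative identity element is $(0,1)$. The ring $R$ is regarded as a subring of $R'$ via $r \mapsto (r,0)$, and "extension" refers to this embedding, i.e. $\tilde{\sigma}(r,0) = (\sigma(r),0)$ and $\tilde{\delta}(r,0) = (\delta(r),0)$ for all $r\in R$. *)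

theory Defs
  imports Complex_Main
begin

text \<open>Rings are types of class \<^class>\<open>ring\<close>, which does not require a multiplicative identity.\<close>

definition ring_endomorphism :: "('a::ring \<Rightarrow> 'a) \<Rightarrow> bool" where
  "ring_endomorphism \<sigma> \<longleftrightarrow>
     Modules.additive \<sigma> \<and> (\<forall>r s. \<sigma> (r * s) = \<sigma> r * \<sigma> s)"

text \<open>The twisting map is meant to be a ring endomorphism; that is stated separately wherever
  the predicate is used.\<close>

definition sigma_derivation :: "('a::ring \<Rightarrow> 'a) \<Rightarrow> ('a \<Rightarrow> 'a) \<Rightarrow> bool" where
  "sigma_derivation \<sigma> \<delta> \<longleftrightarrow>
     Modules.additive \<delta> \<and> (\<forall>r s. \<delta> (r * s) = \<sigma> r * \<delta> s + \<delta> r * s)"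

text \<open>The integer multiple \<open>n x\<close>: without an identity element it cannot be written as
  \<open>of_int n * x\<close>. For either sign of \<open>n\<close> one of the two sums is empty.\<close>

definition int_multiple :: "int \<Rightarrow> 'a::ab_group_add \<Rightarrow> 'a" where
  "int_multiple n x = (\<Sum>i<nat n. x) - (\<Sum>i<nat (- n). x)"

lemma int_multiple_0 [simp]: "int_multiple 0 x = 0"
  by (simp add: int_multiple_def)

lemma int_multiple_plus_1: "int_multiple (n + 1) x = int_multiple n x + x"
proof (cases "n \<ge> 0")
  case True
  then have "nat (n + 1) = Suc (nat n)" "nat (- n) = 0" "nat (- (n + 1)) = 0"
    by auto
  then show ?thesis
    by (simp only: int_multiple_def sum.lessThan_Suc) simp
next
  case False
  then have "nat (- n) = Suc (nat (- (n + 1)))" "nat n = 0" "nat (n + 1) = 0"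
    by auto
  then show ?thesis
    by (simp only: int_multiple_def sum.lessThan_Suc) simp
qed

lemma int_multiple_minus_1: "int_multiple (n - 1) x = int_multiple n x - x"
  using int_multiple_plus_1[of "n - 1" x] by simp

lemma int_multiple_1 [simp]: "int_multiple 1 x = x"
  using int_multiple_plus_1[of 0 x] by simp

lemma int_multiple_add_left: "int_multiple (m + n) x = int_multiple m x + int_multiple n x"
proof (induction n rule: int_induct[of _ 0])
  case (step1 i)
  then show ?case
    using int_multiple_plus_1[of "m + i" x] int_multiple_plus_1[of i x] by (simp add: algebra_simps)
next
  case (step2 i)
  then show ?case
    by (simp only: add_diff_eq[of m i 1] int_multiple_minus_1) (simp add: add_diff_eq)
qed simp

lemma int_multiple_add_right: "int_multiple n (x + y) = int_multiple n x + int_multiple n y"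
  by (simp add: int_multiple_def sum.distrib)

lemma int_multiple_0_right [simp]: "int_multiple n 0 = 0"
  by (simp add: int_multiple_def)

lemma int_multiple_mult: "int_multiple (m * n) x = int_multiple m (int_multiple n x)"
proof (induction m rule: int_induct[of _ 0])
  case (step1 i)
  then show ?case
    by (simp add: int_multiple_add_left int_multiple_plus_1 algebra_simps)
next
  case (step2 i)
  have "int_multiple (i * n) x = int_multiple ((i - 1) * n) x + int_multiple n x"
    by (simp add: int_multiple_add_left[symmetric] algebra_simps)
  with step2 show ?case
    by (simp only: int_multiple_minus_1 eq_diff_eq)
qed simp

lemma int_multiple_mult_left: "int_multiple n x * y = int_multiple n (x * y)"
  for x y :: "'a::ring"
  by (simp add: int_multiple_def left_diff_distrib sum_distrib_right)

lemma int_multiple_mult_right: "x * int_multiple n y = int_multiple n (x * y)"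
  for x y :: "'a::ring"
  by (simp add: int_multiple_def right_diff_distrib sum_distrib_left)

text \<open>A separate type is used instead of \<open>'a \<times> int\<close> because the multiplication is not the
  componentwise one.\<close>

datatype 'a unitalization = Unitalization 'a int

instantiation unitalization :: (ring) ring_1
begin

definition zero_unitalization :: "'a unitalization" where
  "0 = Unitalization 0 0"

definition one_unitalization :: "'a unitalization" where
  "1 = Unitalization 0 1"

fun plus_unitalization :: "'a unitalization \<Rightarrow> 'a unitalization \<Rightarrow> 'a unitalization" where
  "Unitalization r n + Unitalization s m = Unitalization (r + s) (n + m)"

fun uminus_unitalization :: "'a unitalization \<Rightarrow> 'a unitalization" where
  "- Unitalization r n = Unitalization (- r) (- n)"

fun minus_unitalization :: "'a unitalization \<Rightarrow> 'a unitalization \<Rightarrow> 'a unitalization" where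
  "Unitalization r n - Unitalization s m = Unitalization (r - s) (n - m)"

fun times_unitalization :: "'a unitalization \<Rightarrow> 'a unitalization \<Rightarrow> 'a unitalization" where
  "Unitalization r n * Unitalization s m =
     Unitalization (r * s + int_multiple n s + int_multiple m r) (n * m)"

instance
proof
  fix a b c :: "'a unitalization"
  show "a + b + c = a + (b + c)"
    by (cases a; cases b; cases c) (simp add: add.assoc)
  show "a + b = b + a"
    by (cases a; cases b) (simp add: add.commute)
  show "0 + a = a"
    by (cases a) (simp add: zero_unitalization_def)
  show "- a + a = 0"
    by (cases a) (simp add: zero_unitalization_def)
  show "a - b = a + - b"
    by (cases a; cases b) simp
  show "1 * a = a"
    by (cases a) (simp add: one_unitalization_def)
  show "a * 1 = a"
    by (cases a) (simp add: one_unitalization_def)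
  show "(0::'a unitalization) \<noteq> 1"
    by (simp add: zero_unitalization_def one_unitalization_def)
  show "(a + b) * c = a * c + b * c"
    by (cases a; cases b; cases c)
      (simp add: int_multiple_add_left int_multiple_add_right algebra_simps)
  show "a * (b + c) = a * b + a * c"
    by (cases a; cases b; cases c)
      (simp add: int_multiple_add_left int_multiple_add_right algebra_simps)
  show "a * b * c = a * (b * c)"
    by (cases a; cases b; cases c)
      (simp add: int_multiple_add_right int_multiple_mult[symmetric] int_multiple_mult_left
        int_multiple_mult_right algebra_simps)
qed

end

definition unital_embed :: "'a::ring \<Rightarrow> 'a unitalization" where
  "unital_embed r = Unitalization r 0"

lemma unital_embed_eq_iff [simp]: "unital_embed r = unital_embed s \<longleftrightarrow> r = s"
  by (simp add: unital_embed_def)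

lemma unital_embed_add: "unital_embed (r + s) = unital_embed r + unital_embed s"
  by (simp add: unital_embed_def)

lemma unital_embed_mult: "unital_embed (r * s) = unital_embed r * unital_embed s"
  by (simp add: unital_embed_def)

end

theory Submission
  imports Defs
begin

text \<open>Every element of the unitalization is (r,0) + n1, so an additive extension is fixed by
  its value at 1. For \<sigma> that value must be 1, giving (r,n) -> (\<sigma> r, n). A derivation
  twisted by such a map satisfies d(1) = d(1) + d(1), so it kills 1, giving (r,n) -> (\<delta> r,
  0). Both maps respect the product because an additive map commutes with integer multiples
  (\<open>additive_int_multiple\<close>), which are the only new terms in the
  multiplication.\<close>

lemma additive_int_multiple:
  assumes "Modules.additive f"
  shows "f (int_multiple n x) = int_multiple n (f x)"
proof -
  interpret Modules.additive f by fact
  show ?thesis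
    by (simp add: int_multiple_def diff sum)
qed

definition unital_map :: "('a \<Rightarrow> 'b) \<Rightarrow> 'a unitalization \<Rightarrow> 'b unitalization" where
  "unital_map f x = (case x of Unitalization r n \<Rightarrow> Unitalization (f r) n)"

definition unital_zero_extension :: "('a \<Rightarrow> 'b) \<Rightarrow> 'a unitalization \<Rightarrow> 'b unitalization" where
  "unital_zero_extension f x = (case x of Unitalization r n \<Rightarrow> Unitalization (f r) 0)"

lemma unital_map_simps [simp]: "unital_map f (Unitalization r n) = Unitalization (f r) n"
  by (simp add: unital_map_def)

lemma unital_zero_extension_simps [simp]:
  "unital_zero_extension f (Unitalization r n) = Unitalization (f r) 0"
  by (simp add: unital_zero_extension_def)

lemma ring_endomorphism_unital_map:
  assumes "ring_endomorphism f"
  shows "ring_endomorphism (unital_map f)"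
proof -
  have add: "Modules.additive f" and mult: "\<And>r s. f (r * s) = f r * f s"
    using assms by (auto simp: ring_endomorphism_def)
  have "unital_map f (x + y) = unital_map f x + unital_map f y" for x y
    by (cases x; cases y) (simp add: additive.add[OF add])
  moreover have "unital_map f (x * y) = unital_map f x * unital_map f y" for x y
    by (cases x; cases y) (simp add: additive.add[OF add] mult additive_int_multiple[OF add])
  ultimately show ?thesis
    by (simp add: ring_endomorphism_def additive_def)
qed

text \<open>For x = (r,n) and y = (s,m), applying d to rs + ns + mr adds n d(s) + m d(r) to the
  twisted Leibniz rule in the ring. The first of these terms comes from the integer part n of
  \<open>unital_map f x\<close>, the second from the integer part m of y; the other multiples vanish
  because derivative values have integer part 0.\<close>

lemma sigma_derivation_unital_zero_extension:
  assumes "sigma_derivation f d"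
  shows "sigma_derivation (unital_map f) (unital_zero_extension d)"
proof -
  have add: "Modules.additive d" and mult: "\<And>r s. d (r * s) = f r * d s + d r * s"
    using assms by (auto simp: sigma_derivation_def)
  have "unital_zero_extension d (x + y) = unital_zero_extension d x + unital_zero_extension d y"
    for x y
    by (cases x; cases y) (simp add: additive.add[OF add])
  moreover have "unital_zero_extension d (x * y)
      = unital_map f x * unital_zero_extension d y + unital_zero_extension d x * y" for x y
    by (cases x; cases y)
      (simp add: additive.add[OF add] mult additive_int_multiple[OF add] algebra_simps)
  ultimately show ?thesis
    by (simp add: sigma_derivation_def additive_def)
qed

theorem theorem2:
  fixes \<sigma> \<delta> :: "'a::ring \<Rightarrow> 'a"
  assumes "ring_endomorphism \<sigma>"
    and "sigma_derivation \<sigma> \<delta>"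
  shows "\<exists>(\<sigma>' :: 'a unitalization \<Rightarrow> 'a unitalization)
           (\<delta>' :: 'a unitalization \<Rightarrow> 'a unitalization).
           (\<forall>r. \<sigma>' (unital_embed r) = unital_embed (\<sigma> r)) \<and>
           (\<forall>r. \<delta>' (unital_embed r) = unital_embed (\<delta> r)) \<and>
           ring_endomorphism \<sigma>' \<and> \<sigma>' 1 = 1 \<and>
           sigma_derivation \<sigma>' \<delta>'"
proof -
  interpret Modules.additive \<sigma>
    using assms(1) by (simp add: ring_endomorphism_def)
  \<comment> \<open>Since 1 is \<open>Unitalization 0 1\<close>, this amounts to \<sigma> 0 =
    0.\<close>
  have "unital_map \<sigma> 1 = 1"
    by (simp add: one_unitalization_def zero)
  then show ?thesis
    using ring_endomorphism_unital_map[OF assms(1)]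
      sigma_derivation_unital_zero_extension[OF assms(2)]
    by (intro exI[of _ "unital_map \<sigma>"] exI[of _ "unital_zero_extension \<delta>"])
      (simp add: unital_embed_def)
qed

end
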